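(* Let $\mathfrak g$ be a finite-dimensional real Lie algebra and let $\mathfrak i\subseteq\mathfrak g$ be an ideal of dimension $k$. If $(\mathfrak i_t)_{t\in I}$ is a smooth deformation of the ideal $\mathfrak i$ inside $\mathfrak g$, then $$\left.\frac{d}{dt}\right|_{t=0}\mathfrak i_t\in T_{\mathfrak i}\mathrm{Gr}_k(\mathfrak g)\simeq \mathfrak i^*\otimes\mathfrak g/\mathfrak i$$ is a $0$-cocycle in the complex $\big(C^\bullet(\mathfrak g;\mathfrak i^*\otimes\mathfrak g/\mathfrak i),\delta^{\mathrm{Hom}}_{\mathfrak g\rhd\mathfrak i}\big)$.
   Context: $\mathrm{Gr}_k(\mathfrak g)$ is the Grassmannian manifold of $k$-dimensional subspaces of $\mathfrak g$. A smooth deformation $(\mathfrak i_t)_{t\in I}$ of the ideal $\mathfrak i$ inside $\mathfrak g$ is a smooth curve $I=[0,1]\to\mathrm{Gr}_k(\mathfrak g)$, $t\mapsto\mathfrak i_t$, with $\mathfrak i_0=\mathfrak i$ and $\mathfrak i_t$ an ideal of $\mathfrak g$ for all $t\in I$. Canonical identification $T_{\mathfrak i}\mathrm{Gr}_k(\mathfrak g)\simeq\mathfrak i^*\otimes\mathfrak g/\mathfrak i=\mathrm{Hom}(\mathfrak i,\mathfrak g/\mathfrak i)$: for a complement $\mathfrak i^c$ of $\mathfrak i$ in $\mathfrak g$, write $\mathfrak i_t=\mathrm{graph}(\phi(t))$ for small $t$ with a smooth curve $\phi$ in $\mathrm{Hom}(\mathfrak i,\mathfrak i^c)$, $\phi(0)=0$;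 then $\frac{d}{dt}|_{t=0}\mathfrak i_t=\pi_{\mathfrak g/\mathfrak i}\circ\dot\phi(0)$, where $\pi_{\mathfrak g/\mathfrak i}\colon\mathfrak g\to\mathfrak g/\mathfrak i$ is the projection (this is independent of $\mathfrak i^c$). $C^p(\mathfrak g;\mathfrak i^*\otimes\mathfrak g/\mathfrak i)=\wedge^p\mathfrak g^*\otimes\mathfrak i^*\otimes\mathfrak g/\mathfrak i$ is the Chevalley–Eilenberg complex of $\mathfrak g$ with values in the representation $\mathrm{ad}^{\mathrm{Hom}}_x(\phi)(u)=[\bar x,\phi(u)]-\phi([x,u])$ on $\mathrm{Hom}(\mathfrak i,\mathfrak g/\mathfrak i)$ ($x\in\mathfrak g$, $u\in\mathfrak i$, $\bar x=\pi_{\mathfrak g/\mathfrak i}(x)$); its differential is $$\delta^{\mathrm{Hom}}_{\mathfrak g\rhd\mathfrak i}(f)(x_1,\dots,x_{p+1},u)=\sum_{i}(-1)^{i+1}[\overline{x_i},f(x_1,\dots,\widehat{x_i},\dots,x_{p+1},u)]+\sum_{i}(-1)^{i}f(x_1,\dots,\widehat{x_i},\dots,x_{p+1},[x_i,u])+\sum_{i<j}(-1)^{i+j}f([x_i,x_j],x_1,\dots,\widehat{x_i},\dots,\widehat{x_j},\dots,x_{p+1},u).$$ *)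

theory Defs
  imports "HOL-Analysis.Analysis"
begin

section \<open>Finite-dimensional real Lie algebras and ideals\<close>

text \<open>
  The Lie algebra lives on a whole type of class \<open>real_normed_vector\<close>. The norm is auxiliary: it
  is not related to the bracket, and since the dimension is finite, differentiability and
  derivatives of curves do not depend on it. The zero Lie algebra is allowed (which the class
  \<open>euclidean_space\<close> would exclude).
\<close>

definition fd_lie_algebra :: "('g::real_normed_vector \<Rightarrow> 'g \<Rightarrow> 'g) \<Rightarrow> bool" where
  "fd_lie_algebra br \<longleftrightarrow>
     (\<exists>B :: 'g set. finite B \<and> span B = UNIV) \<and>
     bilinear br \<and>
     (\<forall>x. br x x = 0) \<and>
     (\<forall>x y z. br x (br y z) + br y (br z x) + br z (br x y) = 0)"

definition lie_ideal :: "('g::real_normed_vector \<Rightarrow> 'g \<Rightarrow> 'g) \<Rightarrow> 'g set \<Rightarrow> bool" where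
  "lie_ideal br I \<longleftrightarrow> subspace I \<and> (\<forall>x. \<forall>u\<in>I. br x u \<in> I)"

section \<open>The quotient by a subspace\<close>

text \<open>
  Elements of the quotient are cosets, i.e. sets; its zero is the coset \<open>I\<close> itself. The induced
  operations are computed on representatives; the lemmas below record that the choice is immaterial.
\<close>

definition quot_proj :: "'g::real_normed_vector set \<Rightarrow> 'g \<Rightarrow> 'g set" where
  "quot_proj I x = {x + u |u. u \<in> I}"

definition quot_space :: "'g::real_normed_vector set \<Rightarrow> 'g set set" where
  "quot_space I = range (quot_proj I)"

definition quot_rep :: "'g::real_normed_vector set \<Rightarrow> 'g" where
  "quot_rep A = (SOME x. x \<in> A)"

definition quot_add :: "'g::real_normed_vector set \<Rightarrow> 'g set \<Rightarrow> 'g set \<Rightarrow> 'g set" where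
  "quot_add I A B = quot_proj I (quot_rep A + quot_rep B)"

definition quot_scale :: "'g::real_normed_vector set \<Rightarrow> real \<Rightarrow> 'g set \<Rightarrow> 'g set" where
  "quot_scale I r A = quot_proj I (r *\<^sub>R quot_rep A)"

definition quot_sum :: "'g::real_normed_vector set \<Rightarrow> ('b \<Rightarrow> 'g set) \<Rightarrow> 'b set \<Rightarrow> 'g set" where
  "quot_sum I F S = quot_proj I (\<Sum>s\<in>S. quot_rep (F s))"

definition quot_bracket ::
  "('g::real_normed_vector \<Rightarrow> 'g \<Rightarrow> 'g) \<Rightarrow> 'g set \<Rightarrow> 'g set \<Rightarrow> 'g set \<Rightarrow> 'g set" where
  "quot_bracket br I A B = quot_proj I (br (quot_rep A) (quot_rep B))"

lemma quot_proj_eq_iff: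
  assumes "subspace I"
  shows "quot_proj I x = quot_proj I y \<longleftrightarrow> x - y \<in> I"
proof
  assume eq: "quot_proj I x = quot_proj I y"
  have "x \<in> quot_proj I x"
    using subspace_0[OF assms] by (force simp: quot_proj_def)
  then show "x - y \<in> I"
    unfolding eq by (auto simp: quot_proj_def)
next
  assume d: "x - y \<in> I"
  have "x + u = y + ((x - y) + u)" "y + u = x + (u - (x - y))" for u
    by (auto simp: algebra_simps)
  then show "quot_proj I x = quot_proj I y"
    using subspace_add[OF assms d] subspace_diff[OF assms _ d]
    unfolding quot_proj_def by blast
qed

lemma quot_proj_eq_zero_iff:
  assumes "subspace I"
  shows "quot_proj I x = I \<longleftrightarrow> x \<in> I"
proof -
  have "quot_proj I 0 = I" by (auto simp: quot_proj_def)
  then show ?thesis using quot_proj_eq_iff[OF assms, of x 0] by simp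
qed

lemma quot_rep_proj:
  assumes "subspace I"
  shows "quot_rep (quot_proj I x) - x \<in> I"
proof -
  have "x \<in> quot_proj I x"
    using subspace_0[OF assms] by (force simp: quot_proj_def)
  then have "quot_rep (quot_proj I x) \<in> quot_proj I x"
    unfolding quot_rep_def by (rule someI)
  then show ?thesis by (auto simp: quot_proj_def)
qed

lemma quot_add_proj:
  assumes "subspace I"
  shows "quot_add I (quot_proj I x) (quot_proj I y) = quot_proj I (x + y)"
  unfolding quot_add_def quot_proj_eq_iff[OF assms]
  using subspace_add[OF assms quot_rep_proj[OF assms, of x] quot_rep_proj[OF assms, of y]]
  by (simp add: algebra_simps)

lemma quot_scale_proj:
  assumes "subspace I"
  shows "quot_scale I r (quot_proj I x) = quot_proj I (r *\<^sub>R x)"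
  unfolding quot_scale_def quot_proj_eq_iff[OF assms]
  using subspace_scale[OF assms quot_rep_proj[OF assms, of x], of r]
  by (simp add: algebra_simps)

lemma quot_sum_proj:
  assumes "subspace I"
  shows "quot_sum I (\<lambda>s. quot_proj I (F s)) S = quot_proj I (\<Sum>s\<in>S. F s)"
  unfolding quot_sum_def quot_proj_eq_iff[OF assms] sum_subtractf[symmetric]
  by (rule subspace_sum[OF assms]) (rule quot_rep_proj[OF assms])

lemma quot_bracket_proj:
  assumes "fd_lie_algebra br" "lie_ideal br I"
  shows "quot_bracket br I (quot_proj I x) (quot_proj I y) = quot_proj I (br x y)"
proof -
  have bil: "bilinear br" and alt: "br z z = 0" for z
    using assms(1) by (auto simp: fd_lie_algebra_def)
  have I: "subspace I" and id: "u \<in> I \<Longrightarrow> br z u \<in> I" for z u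
    using assms(2) by (auto simp: lie_ideal_def)
  have skew: "br a b = - br b a" for a b
    using alt[of "a + b"] alt[of a] alt[of b]
    by (simp add: bilinear_ladd[OF bil] bilinear_radd[OF bil] eq_neg_iff_add_eq_0 add.commute)
  define a b where "a = quot_rep (quot_proj I x)" and "b = quot_rep (quot_proj I y)"
  have "a - x \<in> I" "b - y \<in> I"
    unfolding a_def b_def by (rule quot_rep_proj[OF I])+
  then have "br a (b - y) + - br y (a - x) \<in> I"
    by (intro subspace_add[OF I] subspace_neg[OF I] id)
  moreover have "br a (b - y) + - br y (a - x) = br a b - br x y"
    using skew[of y a] skew[of y x] by (simp add: bilinear_rsub[OF bil])
  ultimately show ?thesis
    by (simp add: quot_bracket_def quot_proj_eq_iff[OF I] a_def b_def)
qed

section \<open>The space of linear maps from an ideal to the quotient\<close>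

text \<open>Maps are extensional, i.e. \<open>undefined\<close> off \<open>I\<close>, so that equal maps are equal functions.\<close>

definition hom_quot :: "'g::real_normed_vector set \<Rightarrow> ('g \<Rightarrow> 'g set) set" where
  "hom_quot I = {\<xi> \<in> I \<rightarrow>\<^sub>E quot_space I.
     \<forall>u\<in>I. \<forall>v\<in>I. \<forall>r s. \<xi> (r *\<^sub>R u + s *\<^sub>R v) =
       quot_add I (quot_scale I r (\<xi> u)) (quot_scale I s (\<xi> v))}"

definition hom_quot_zero :: "'g::real_normed_vector set \<Rightarrow> 'g \<Rightarrow> 'g set" where
  "hom_quot_zero I = (\<lambda>u\<in>I. quot_proj I 0)"

section \<open>The Chevalley--Eilenberg complex\<close>

text \<open>
  A \<open>p\<close>-cochain maps lists \<open>[x\<^sub>0, \<dots>, x\<^sub>p\<^sub>-\<^sub>1]\<close> of length \<open>p\<close> multilinearly and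
  alternatingly to linear maps from \<open>I\<close> to the quotient.
\<close>

definition ce_cochains :: "'g::real_normed_vector set \<Rightarrow> nat \<Rightarrow> ('g list \<Rightarrow> 'g \<Rightarrow> 'g set) set" where
  "ce_cochains I p = {f \<in> {xs. length xs = p} \<rightarrow>\<^sub>E hom_quot I.
     (\<forall>xs a x y r s. \<forall>u\<in>I. length xs = p \<longrightarrow> a < p \<longrightarrow>
        f (xs[a := r *\<^sub>R x + s *\<^sub>R y]) u =
          quot_add I (quot_scale I r (f (xs[a := x]) u)) (quot_scale I s (f (xs[a := y]) u))) \<and>
     (\<forall>xs a b. length xs = p \<longrightarrow> a < b \<longrightarrow> b < p \<longrightarrow> xs ! a = xs ! b \<longrightarrow>
        f xs = hom_quot_zero I)}"

definition ce_zero :: "'g::real_normed_vector set \<Rightarrow> nat \<Rightarrow> 'g list \<Rightarrow> 'g \<Rightarrow> 'g set" where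
  "ce_zero I p = (\<lambda>xs\<in>{xs. length xs = p}. hom_quot_zero I)"

definition omit :: "nat \<Rightarrow> 'a list \<Rightarrow> 'a list" where
  "omit a xs = take a xs @ drop (Suc a) xs"

text \<open>
  List positions start at \<open>0\<close>, so compared with the usual formula for arguments
  \<open>x\<^sub>1, \<dots>, x\<^sub>p\<^sub>+\<^sub>1\<close> the exponents of \<open>-1\<close> in the first two sums shift by one; in the third
  they shift by two.
\<close>

definition ce_diff ::
  "('g::real_normed_vector \<Rightarrow> 'g \<Rightarrow> 'g) \<Rightarrow> 'g set \<Rightarrow> nat \<Rightarrow>
     ('g list \<Rightarrow> 'g \<Rightarrow> 'g set) \<Rightarrow> 'g list \<Rightarrow> 'g \<Rightarrow> 'g set" where
  "ce_diff br I p f = (\<lambda>xs\<in>{xs. length xs = p + 1}. \<lambda>u\<in>I.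
     quot_add I
       (quot_add I
         (quot_sum I (\<lambda>a. quot_scale I ((-1) ^ a)
            (quot_bracket br I (quot_proj I (xs ! a)) (f (omit a xs) u))) {..<p + 1})
         (quot_sum I (\<lambda>a. quot_scale I ((-1) ^ (a + 1))
            (f (omit a xs) (br (xs ! a) u))) {..<p + 1}))
       (quot_sum I (\<lambda>(a, b). quot_scale I ((-1) ^ (a + b))
          (f (br (xs ! a) (xs ! b) # omit a (omit b xs)) u)) {(a, b). a < b \<and> b < p + 1}))"

definition ce_cocycles ::
  "('g::real_normed_vector \<Rightarrow> 'g \<Rightarrow> 'g) \<Rightarrow> 'g set \<Rightarrow> nat \<Rightarrow> ('g list \<Rightarrow> 'g \<Rightarrow> 'g set) set" where
  "ce_cocycles br I p = {f \<in> ce_cochains I p. ce_diff br I p f = ce_zero I (p + 1)}"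

text \<open>The identification of linear maps with \<open>0\<close>-cochains.\<close>

definition cochain0 :: "('g \<Rightarrow> 'g set) \<Rightarrow> 'g list \<Rightarrow> 'g \<Rightarrow> 'g set" where
  "cochain0 \<xi> = (\<lambda>xs\<in>{xs. length xs = 0}. \<xi>)"

section \<open>Smooth curves in the Grassmannian\<close>

definition Gr :: "nat \<Rightarrow> 'g::real_normed_vector set set" where
  "Gr k = {V. subspace V \<and> dim V = k}"

text \<open>
  Derivatives are taken within \<open>S\<close>, hence one-sided at end points of an interval.
\<close>

definition smooth_curve_on :: "real set \<Rightarrow> (real \<Rightarrow> 'g::real_normed_vector) \<Rightarrow> bool" where
  "smooth_curve_on S c \<longleftrightarrow> (\<exists>D. D (0::nat) = c \<and>
     (\<forall>n. \<forall>t\<in>S. (D n has_vector_derivative D (Suc n) t) (at t within S)))"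

definition complement :: "'g::real_normed_vector set \<Rightarrow> 'g set \<Rightarrow> bool" where
  "complement V C \<longleftrightarrow> subspace C \<and> V \<inter> C = {0} \<and> {v + c |v c. v \<in> V \<and> c \<in> C} = UNIV"

definition linear_between ::
  "'g::real_normed_vector set \<Rightarrow> 'g set \<Rightarrow> ('g \<Rightarrow> 'g) \<Rightarrow> bool" where
  "linear_between V C \<phi> \<longleftrightarrow> \<phi> ` V \<subseteq> C \<and>
     (\<forall>u\<in>V. \<forall>v\<in>V. \<forall>r s. \<phi> (r *\<^sub>R u + s *\<^sub>R v) = r *\<^sub>R \<phi> u + s *\<^sub>R \<phi> v)"

definition graph_of :: "'g::real_normed_vector set \<Rightarrow> ('g \<Rightarrow> 'g) \<Rightarrow> 'g set" where
  "graph_of V \<phi> = {u + \<phi> u |u. u \<in> V}"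

text \<open>
  \<open>\<phi>\<close> is the expression of the curve \<open>\<gamma>\<close> near \<open>t0\<close> in the chart of the Grassmannian given by the
  decomposition of the whole space into \<open>\<gamma> t0\<close> and \<open>C\<close>. Smoothness of \<open>\<phi>\<close> as a curve in the
  finite-dimensional space of linear maps amounts to smoothness of its evaluations; \<open>\<phi> t0 = 0\<close>
  on \<open>\<gamma> t0\<close> is automatic.
\<close>

definition gr_local_rep ::
  "real set \<Rightarrow> (real \<Rightarrow> 'g::real_normed_vector set) \<Rightarrow> real \<Rightarrow> 'g set \<Rightarrow> (real \<Rightarrow> 'g \<Rightarrow> 'g) \<Rightarrow> bool" where
  "gr_local_rep T \<gamma> t0 C \<phi> \<longleftrightarrow> complement (\<gamma> t0) C \<and>
     (\<exists>\<epsilon>>0. (\<forall>t\<in>T \<inter> ball t0 \<epsilon>. linear_between (\<gamma> t0) C (\<phi> t) \<and> \<gamma> t = graph_of (\<gamma> t0) (\<phi> t)) \<and>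
            (\<forall>u\<in>\<gamma> t0. smooth_curve_on (T \<inter> ball t0 \<epsilon>) (\<lambda>t. \<phi> t u)))"

definition smooth_gr_curve ::
  "nat \<Rightarrow> real set \<Rightarrow> (real \<Rightarrow> 'g::real_normed_vector set) \<Rightarrow> bool" where
  "smooth_gr_curve k T \<gamma> \<longleftrightarrow> \<gamma> ` T \<subseteq> Gr k \<and> (\<forall>t0\<in>T. \<exists>C \<phi>. gr_local_rep T \<gamma> t0 C \<phi>)"

text \<open>
  The velocity at \<open>t0\<close>, as an element of \<open>hom_quot (\<gamma> t0)\<close>. For a smooth curve on a
  nondegenerate interval it exists and does not depend on \<open>C\<close> and \<open>\<phi>\<close>, so that the description
  is proper.
\<close>

definition gr_velocity ::
  "real set \<Rightarrow> (real \<Rightarrow> 'g::real_normed_vector set) \<Rightarrow> real \<Rightarrow> 'g \<Rightarrow> 'g set" where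
  "gr_velocity T \<gamma> t0 = (THE \<xi>. \<exists>C \<phi>. gr_local_rep T \<gamma> t0 C \<phi> \<and>
     \<xi> = (\<lambda>u\<in>\<gamma> t0. quot_proj (\<gamma> t0) (vector_derivative (\<lambda>t. \<phi> t u) (at t0 within T))))"

definition smooth_ideal_deformation ::
  "('g::real_normed_vector \<Rightarrow> 'g \<Rightarrow> 'g) \<Rightarrow> nat \<Rightarrow> 'g set \<Rightarrow> (real \<Rightarrow> 'g set) \<Rightarrow> bool" where
  "smooth_ideal_deformation br k I \<gamma> \<longleftrightarrow>
     smooth_gr_curve k {0..1} \<gamma> \<and> \<gamma> 0 = I \<and> (\<forall>t\<in>{0..1}. lie_ideal br (\<gamma> t))"

end

theory Submission
  imports Defs
begin

text \<open>
  The velocity of a smooth curve \<open>\<gamma>\<close> of subspaces at \<open>t0\<close> sends \<open>u \<in> \<gamma> t0\<close> to the class modulo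
  \<open>\<gamma> t0\<close> of \<open>c'(t0)\<close>, where \<open>c\<close> is \<^emph>\<open>any\<close> differentiable curve with \<open>c t \<in> \<gamma> t\<close> and \<open>c t0 = u\<close>
  (lemma \<open>velocity_of_section\<close>). Everything is an application of this to a suitable section \<open>c\<close>.

  \<^item> Sections \<open>u + \<psi> t u\<close> read off from a second chart show that the velocity is independent of
    the chart (lemma \<open>gr_velocity_eq\<close>).
  \<^item> Linear combinations of sections show that it is linear.
  \<^item> If all \<open>\<gamma> t\<close> are ideals and \<open>\<phi>\<close> represents \<open>\<gamma>\<close> in a chart, then \<open>t \<mapsto> [x, u + \<phi> t u]\<close> is a
    section through \<open>[x, u]\<close>, so the velocity maps \<open>[x, u]\<close> to the class of \<open>[x, \<phi>'(u)]\<close>. This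
    is the cocycle identity in degree \<open>0\<close>.

  To prove the lemma on sections, write \<open>P\<close> for the projection onto \<open>\<gamma> t0\<close> along the chosen
  complement. A section satisfies \<open>c t = P (c t) + \<phi> t (P (c t))\<close>, and since \<open>\<phi> t0 = 0\<close> the
  product rule gives \<open>c'(t0) = P (c'(t0)) + \<phi>'(u)\<close>, whose first summand lies in \<open>\<gamma> t0\<close>.
  Differentiating \<open>P\<close>, coordinates and the bracket uses that linear maps on a finite-dimensional
  normed space are bounded (lemma \<open>finite_dim_linear_imp_bounded_linear\<close>); this is derived from a
  bound on the coordinates of a vector by its norm.
\<close>

section \<open>Linear maps on finite-dimensional normed spaces\<close>

text \<open>
  In the induction step the new basis vector \<open>a\<close> must have positive distance from the span of the
  others. Otherwise some sequence in that span converges to \<open>a\<close>; by the induction hypothesis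
  its coordinates are Cauchy, so the limit stays in the span, contradicting independence.
\<close>

lemma independent_coordinates_bounded:
  fixes B :: "'a::real_normed_vector set"
  assumes "finite B" "independent B"
  shows "\<exists>K\<ge>0. \<forall>c. \<forall>b\<in>B. \<bar>c b\<bar> \<le> K * norm (\<Sum>b\<in>B. c b *\<^sub>R b)"
  using assms
proof (induction B rule: finite_induct)
  case empty
  then show ?case by (auto intro!: exI[of _ 0])
next
  case (insert a B)
  have indB: "independent B" and aB: "a \<notin> span B"
    using insert.prems insert.hyps by (auto simp: independent_insert)
  obtain K where K0: "K \<ge> 0" and K: "\<And>c b. b \<in> B \<Longrightarrow> \<bar>c b\<bar> \<le> K * norm (\<Sum>b\<in>B. c b *\<^sub>R b)"
    using insert.IH[OF indB] by blast
  have "\<exists>d>0. \<forall>v\<in>span B. d \<le> norm (a - v)"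
  proof (rule ccontr)
    assume "\<not> ?thesis"
    then have "\<exists>v\<in>span B. norm (a - v) < 1 / Suc n" for n
      by (meson not_le of_nat_0_less_iff zero_less_Suc zero_less_divide_1_iff)
    then obtain v where vB: "\<And>n. v n \<in> span B" and va: "\<And>n. norm (a - v n) < 1 / Suc n"
      by metis
    have "\<exists>c. v n = (\<Sum>b\<in>B. c b *\<^sub>R b)" for n
      using vB[of n] span_finite[OF insert.hyps(1)] by auto
    then obtain c where c: "\<And>n. v n = (\<Sum>b\<in>B. c n b *\<^sub>R b)" by metis
    have lim: "v \<longlonglongrightarrow> a"
    proof -
      have "(\<lambda>n. v n - a) \<longlonglongrightarrow> 0"
        by (rule Lim_null_comparison[OF _ LIMSEQ_inverse_real_of_nat])
           (use va in \<open>auto simp: norm_minus_commute inverse_eq_divide intro!: always_eventually less_imp_le\<close>)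
      then show ?thesis by (simp add: LIM_zero_iff)
    qed
    \<comment> \<open>Dividing by \<open>K + 1\<close> below covers the case \<open>K = 0\<close>.\<close>
    have "convergent (\<lambda>n. c n b)" if b: "b \<in> B" for b
    proof -
      have le: "\<bar>c m b - c n b\<bar> \<le> K * norm (v m - v n)" for m n
        using K[OF b, of "\<lambda>b. c m b - c n b"]
        by (simp add: c scaleR_left_diff_distrib sum_subtractf)
      have "Cauchy (\<lambda>n. c n b)"
      proof (rule CauchyI)
        fix e :: real assume "e > 0"
        then have "e / (K + 1) > 0" using K0 by simp
        then obtain M where M: "\<And>m n. m \<ge> M \<Longrightarrow> n \<ge> M \<Longrightarrow> norm (v m - v n) < e / (K + 1)"
          using LIMSEQ_imp_Cauchy[OF lim] unfolding Cauchy_iff by blast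
        have "norm (c m b - c n b) < e" if "m \<ge> M" "n \<ge> M" for m n
        proof -
          have "K * norm (v m - v n) \<le> K * (e / (K + 1))"
            using M[OF that] K0 by (intro mult_left_mono) auto
          also have "\<dots> < e" using K0 \<open>e > 0\<close> by (simp add: field_simps)
          finally show ?thesis using le[of m n] by simp
        qed
        then show "\<exists>M. \<forall>m\<ge>M. \<forall>n\<ge>M. norm (c m b - c n b) < e" by blast
      qed
      then show ?thesis by (rule Cauchy_convergent)
    qed
    then obtain l where l: "\<And>b. b \<in> B \<Longrightarrow> (\<lambda>n. c n b) \<longlonglongrightarrow> l b"
      unfolding convergent_def by metis
    have "v \<longlonglongrightarrow> (\<Sum>b\<in>B. l b *\<^sub>R b)"
      unfolding c by (intro tendsto_sum tendsto_scaleR l tendsto_const)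
    then have "a = (\<Sum>b\<in>B. l b *\<^sub>R b)" using lim LIMSEQ_unique by blast
    then have "a \<in> span B" by (simp add: span_sum span_scale span_base)
    with aB show False by simp
  qed
  then obtain d where d0: "d > 0" and d: "\<And>v. v \<in> span B \<Longrightarrow> d \<le> norm (a - v)" by blast
  \<comment> \<open>With \<open>N\<close> the norm of the whole vector, the coordinate at \<open>a\<close> is at most \<open>N / d\<close>, so the part in
    \<open>span B\<close> has norm at most \<open>N * (1 + norm a / d)\<close>; \<open>L\<close> covers both kinds of coordinates.\<close>
  define L where "L = 1 / d + K * (1 + norm a / d)"
  have "\<bar>c b\<bar> \<le> L * norm (\<Sum>b\<in>insert a B. c b *\<^sub>R b)" if b: "b \<in> insert a B" for c b
  proof -
    define s where "s = (\<Sum>b\<in>B. c b *\<^sub>R b)"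
    define N where "N = norm (c a *\<^sub>R a + s)"
    have sum: "norm (\<Sum>b\<in>insert a B. c b *\<^sub>R b) = N"
      using insert.hyps by (simp add: N_def s_def)
    have N0: "N \<ge> 0" by (simp add: N_def)
    have sB: "s \<in> span B" by (simp add: s_def span_sum span_scale span_base)
    have ca: "\<bar>c a\<bar> * d \<le> N"
    proof (cases "c a = 0")
      case False
      have "d \<le> norm (a - (- (1 / c a)) *\<^sub>R s)"
        by (intro d span_scale sB)
      then have "\<bar>c a\<bar> * d \<le> \<bar>c a\<bar> * norm (a + (1 / c a) *\<^sub>R s)"
        by (intro mult_left_mono) auto
      also have "\<dots> = norm (c a *\<^sub>R (a + (1 / c a) *\<^sub>R s))" by simp
      also have "\<dots> = N" using False by (simp add: N_def scaleR_add_right)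
      finally show ?thesis .
    qed (simp add: N0)
    then have ca': "\<bar>c a\<bar> \<le> N / d" using d0 by (simp add: field_simps)
    have "norm s = norm ((c a *\<^sub>R a + s) - c a *\<^sub>R a)" by simp
    also have "\<dots> \<le> N + \<bar>c a\<bar> * norm a"
      unfolding N_def by (rule order_trans[OF norm_triangle_ineq4]) simp
    also have "\<dots> \<le> N + (N / d) * norm a"
      using ca' by (intro add_left_mono mult_right_mono) auto
    finally have s: "norm s \<le> N * (1 + norm a / d)" by (simp add: algebra_simps)
    have Ld: "L * N = N / d + K * (N * (1 + norm a / d))"
      by (simp add: L_def algebra_simps)
    have Kn: "K * (N * (1 + norm a / d)) \<ge> 0" and Nd: "N / d \<ge> 0"
      using K0 N0 d0 by auto
    show ?thesis
    proof (cases "b = a")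
      case True
      then show ?thesis using ca' Kn unfolding sum Ld by simp
    next
      case False
      with b have "\<bar>c b\<bar> \<le> K * norm s" unfolding s_def by (intro K) auto
      also have "\<dots> \<le> K * (N * (1 + norm a / d))" by (intro mult_left_mono s K0)
      finally show ?thesis using Nd unfolding sum Ld by simp
    qed
  qed
  moreover have "L \<ge> 0" using K0 d0 by (simp add: L_def)
  ultimately show ?case by blast
qed

lemma finite_dim_linear_imp_bounded_linear:
  fixes f :: "'a::real_normed_vector \<Rightarrow> 'b::real_normed_vector"
  assumes fin: "finite S" and span: "span S = (UNIV :: 'a set)" and lin: "linear f"
  shows "bounded_linear f"
proof -
  obtain B :: "'a set" where B: "independent B" "UNIV \<subseteq> span B"
    using basis_exists[of UNIV] by metis
  have finB: "finite B"
    using independent_span_bound[OF fin B(1)] span by simp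
  obtain K where K0: "K \<ge> 0" and K: "\<And>c b. b \<in> B \<Longrightarrow> \<bar>c b\<bar> \<le> K * norm (\<Sum>b\<in>B. c b *\<^sub>R b)"
    using independent_coordinates_bounded[OF finB B(1)] by blast
  have "norm (f x) \<le> norm x * (K * (\<Sum>b\<in>B. norm (f b)))" for x
  proof -
    obtain c where c: "x = (\<Sum>b\<in>B. c b *\<^sub>R b)"
      using B(2) span_finite[OF finB] by blast
    have "norm (f x) = norm (\<Sum>b\<in>B. c b *\<^sub>R f b)"
      by (simp add: c linear_sum[OF lin] linear_cmul[OF lin])
    also have "\<dots> \<le> (\<Sum>b\<in>B. \<bar>c b\<bar> * norm (f b))"
      by (rule order_trans[OF norm_sum]) simp
    also have "\<dots> \<le> (\<Sum>b\<in>B. (K * norm x) * norm (f b))"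
      unfolding c by (intro sum_mono mult_right_mono K) auto
    finally show ?thesis by (simp add: sum_distrib_left mult_ac)
  qed
  then show ?thesis
    using lin by (intro bounded_linear_intro[of f "K * (\<Sum>b\<in>B. norm (f b))"])
      (auto simp: linear_add linear_cmul)
qed

section \<open>Charts of the Grassmannian\<close>

lemma complement_projection:
  assumes V: "subspace V" and C: "complement V C"
  obtains P where "linear P" "\<And>x. P x \<in> V" "\<And>v c. v \<in> V \<Longrightarrow> c \<in> C \<Longrightarrow> P (v + c) = v"
proof -
  have sC: "subspace C" and int: "V \<inter> C = {0}"
    and dec: "\<And>x. \<exists>v\<in>V. \<exists>c\<in>C. x = v + c"
    using C unfolding complement_def by blast+
  obtain P Q where PQ: "\<And>x. P x \<in> V" "\<And>x. Q x \<in> C" "\<And>x. x = P x + Q x"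
    using dec by metis
  have uniq: "P (v + c) = v" if "v \<in> V" "c \<in> C" for v c
  proof -
    have "P (v + c) - v = c - Q (v + c)"
      using PQ(3)[of "v + c"] by (simp add: algebra_simps)
    moreover have "P (v + c) - v \<in> V" "c - Q (v + c) \<in> C"
      using that PQ(1,2) by (simp_all add: subspace_diff V sC)
    ultimately have "P (v + c) - v \<in> V \<inter> C" by simp
    then show ?thesis unfolding int by simp
  qed
  have "linear P"
  proof (rule linearI)
    fix x y
    have "P ((P x + P y) + (Q x + Q y)) = P x + P y"
      by (intro uniq subspace_add[OF V] subspace_add[OF sC] PQ)
    moreover have "(P x + P y) + (Q x + Q y) = x + y"
      using PQ(3)[of x] PQ(3)[of y] by (simp add: algebra_simps)
    ultimately show "P (x + y) = P x + P y" by simp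
  next
    fix r x
    have "P (r *\<^sub>R P x + r *\<^sub>R Q x) = r *\<^sub>R P x"
      by (intro uniq subspace_scale[OF V] subspace_scale[OF sC] PQ)
    then show "P (r *\<^sub>R x) = r *\<^sub>R P x"
      using PQ(3)[of x] by (metis scaleR_add_right)
  qed
  with PQ(1) uniq that show ?thesis by blast
qed

lemma linear_between_sum:
  assumes V: "subspace V" and \<phi>: "linear_between V C \<phi>" and "finite B" "B \<subseteq> V"
  shows "\<phi> (\<Sum>b\<in>B. r b *\<^sub>R b) = (\<Sum>b\<in>B. r b *\<^sub>R \<phi> b)"
  using assms(3,4)
proof (induction B rule: finite_induct)
  case empty
  have "\<phi> (0 *\<^sub>R 0 + 0 *\<^sub>R 0) = 0 *\<^sub>R \<phi> 0 + 0 *\<^sub>R \<phi> 0"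
    using \<phi> subspace_0[OF V] unfolding linear_between_def by blast
  then show ?case by simp
next
  case (insert a B)
  have "(\<Sum>b\<in>B. r b *\<^sub>R b) \<in> V"
    using insert.prems by (intro subspace_sum[OF V] subspace_scale[OF V]) auto
  then have "\<phi> (r a *\<^sub>R a + 1 *\<^sub>R (\<Sum>b\<in>B. r b *\<^sub>R b)) = r a *\<^sub>R \<phi> a + 1 *\<^sub>R \<phi> (\<Sum>b\<in>B. r b *\<^sub>R b)"
    using \<phi> insert.prems unfolding linear_between_def by blast
  then show ?case using insert by simp
qed

lemma gr_local_rep_zero:
  assumes rep: "gr_local_rep T \<gamma> t0 C \<phi>" and V: "subspace (\<gamma> t0)" and "t0 \<in> T" "u \<in> \<gamma> t0"
  shows "\<phi> t0 u = 0"
proof -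
  have int: "\<gamma> t0 \<inter> C = {0}"
    using rep unfolding gr_local_rep_def complement_def by blast
  obtain \<epsilon> where "\<epsilon> > 0" and
    local: "\<forall>t\<in>T \<inter> ball t0 \<epsilon>. linear_between (\<gamma> t0) C (\<phi> t) \<and> \<gamma> t = graph_of (\<gamma> t0) (\<phi> t)"
    using rep unfolding gr_local_rep_def by blast
  have "t0 \<in> T \<inter> ball t0 \<epsilon>" using \<open>t0 \<in> T\<close> \<open>\<epsilon> > 0\<close> by simp
  note lb = local[THEN bspec, OF this, THEN conjunct1]
    and g = local[THEN bspec, OF this, THEN conjunct2]
  have "u + \<phi> t0 u \<in> \<gamma> t0"
    by (subst g) (use \<open>u \<in> \<gamma> t0\<close> in \<open>auto simp: graph_of_def\<close>)
  then have "(u + \<phi> t0 u) - u \<in> \<gamma> t0"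
    using \<open>u \<in> \<gamma> t0\<close> by (rule subspace_diff[OF V])
  moreover have "\<phi> t0 u \<in> C" using lb \<open>u \<in> \<gamma> t0\<close> by (auto simp: linear_between_def)
  ultimately have "\<phi> t0 u \<in> \<gamma> t0 \<inter> C" by simp
  then show ?thesis unfolding int by simp
qed

lemma gr_local_rep_has_derivative:
  assumes rep: "gr_local_rep T \<gamma> t0 C \<phi>" and "t0 \<in> T" "u \<in> \<gamma> t0"
  shows "((\<lambda>t. \<phi> t u) has_vector_derivative vector_derivative (\<lambda>t. \<phi> t u) (at t0 within T))
           (at t0 within T)"
proof -
  obtain \<epsilon> where "\<epsilon> > 0" and "smooth_curve_on (T \<inter> ball t0 \<epsilon>) (\<lambda>t. \<phi> t u)"
    using rep \<open>u \<in> \<gamma> t0\<close> unfolding gr_local_rep_def by blast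
  then obtain y where "((\<lambda>t. \<phi> t u) has_vector_derivative y) (at t0 within T \<inter> ball t0 \<epsilon>)"
    using \<open>t0 \<in> T\<close> unfolding smooth_curve_on_def
    by (metis IntI centre_in_ball)
  moreover have "at t0 within T \<inter> ball t0 \<epsilon> = at t0 within T"
    by (rule at_within_nhd[of _ "ball t0 \<epsilon>"]) (use \<open>\<epsilon> > 0\<close> in auto)
  ultimately have "(\<lambda>t. \<phi> t u) differentiable (at t0 within T)"
    by (auto simp: differentiable_def has_vector_derivative_def)
  then show ?thesis by (simp add: vector_derivative_works)
qed

section \<open>The velocity in terms of sections\<close>

text \<open>
  The quotient makes the tangential part \<open>P (c'(t0))\<close> invisible, so only the derivative
  of the chart representative survives.
\<close>

lemma velocity_of_section:
  fixes \<gamma> :: "real \<Rightarrow> 'g::real_normed_vector set"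
  assumes fin: "finite S" and span: "span S = (UNIV :: 'g set)"
    and V: "subspace (\<gamma> t0)" and rep: "gr_local_rep T \<gamma> t0 C \<phi>"
    and t0: "t0 \<in> T" and nontriv: "at t0 within T \<noteq> bot"
    and c: "(c has_vector_derivative c') (at t0 within T)"
    and sec: "\<forall>\<^sub>F t in at t0 within T. c t \<in> \<gamma> t" and c0: "c t0 = u" and u: "u \<in> \<gamma> t0"
  shows "c' - vector_derivative (\<lambda>t. \<phi> t u) (at t0 within T) \<in> \<gamma> t0"
proof -
  define V where "V = \<gamma> t0"
  define D where "D v = vector_derivative (\<lambda>t. \<phi> t v) (at t0 within T)" for v
  have sV: "subspace V" using V by (simp add: V_def)
  have D: "((\<lambda>t. \<phi> t v) has_vector_derivative D v) (at t0 within T)" if "v \<in> V" for v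
    using gr_local_rep_has_derivative[OF rep t0] that by (simp add: D_def V_def)
  obtain P where linP: "linear P" and PV: "\<And>x. P x \<in> V"
    and P: "\<And>v w. v \<in> V \<Longrightarrow> w \<in> C \<Longrightarrow> P (v + w) = v"
    using complement_projection[OF sV] rep unfolding gr_local_rep_def V_def by metis
  obtain \<epsilon> where \<epsilon>: "\<epsilon> > 0"
    and lb: "\<And>t. t \<in> T \<Longrightarrow> dist t t0 < \<epsilon> \<Longrightarrow> linear_between V C (\<phi> t)"
    and gr: "\<And>t. t \<in> T \<Longrightarrow> dist t t0 < \<epsilon> \<Longrightarrow> \<gamma> t = graph_of V (\<phi> t)"
    using rep unfolding gr_local_rep_def V_def by (auto simp: dist_commute Ball_def)
  obtain \<delta> where \<delta>: "\<delta> > 0" and sec': "\<And>t. t \<in> T \<Longrightarrow> t \<noteq> t0 \<Longrightarrow> dist t t0 < \<delta> \<Longrightarrow> c t \<in> \<gamma> t"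
    using sec unfolding eventually_at by blast
  obtain B where B: "B \<subseteq> V" "independent B" "V \<subseteq> span B"
    using basis_exists[of V] by metis
  have finB: "finite B" using independent_span_bound[OF fin B(2)] span by simp
  have spanB: "span B = V" using B span_minimal[OF B(1) sV] by blast
  \<comment> \<open>Coordinates of \<open>P x\<close> rather than of \<open>x\<close>: \<open>representation B\<close> is linear only on \<open>span B\<close>, whereas
    \<open>q b\<close> is linear on the whole space and hence bounded.\<close>
  define q where "q b x = representation B (P x) b" for b x
  have Pq: "P x = (\<Sum>b\<in>B. q b x *\<^sub>R b)" for x
    unfolding q_def
    using real_vector.sum_representation_eq[OF B(2), of "P x" B] PV spanB finB by simp
  have linq: "linear (q b)" for b
    by (rule linearI)
       (use PV spanB B(2) in \<open>simp_all add: q_def linear_add[OF linP] linear_cmul[OF linP]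
          real_vector.representation_add real_vector.representation_scale\<close>)
  have bq: "bounded_linear (q b)" for b
    by (rule finite_dim_linear_imp_bounded_linear[OF fin span linq])
  have bP: "bounded_linear P"
    by (rule finite_dim_linear_imp_bounded_linear[OF fin span linP])
  have eq: "P (c t) + (\<Sum>b\<in>B. q b (c t) *\<^sub>R \<phi> t b) = c t" if t: "t \<in> T" "dist t t0 < min \<delta> \<epsilon>" for t
  proof -
    have "c t \<in> \<gamma> t" using sec'[of t] t c0 u by (cases "t = t0") auto
    then obtain v where v: "v \<in> V" "c t = v + \<phi> t v"
      using gr[of t] t by (auto simp: graph_of_def)
    then have Pc: "P (c t) = v" using P[of v "\<phi> t v"] lb[of t] t by (auto simp: linear_between_def)
    have "\<phi> t (P (c t)) = (\<Sum>b\<in>B. q b (c t) *\<^sub>R \<phi> t b)"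
      unfolding Pq by (rule linear_between_sum[OF sV lb finB B(1)]) (use t in auto)
    with v Pc show ?thesis by simp
  qed
  have zero: "\<phi> t0 b = 0" if "b \<in> B" for b
    using gr_local_rep_zero[OF rep V t0] that B(1) by (auto simp: V_def)
  have u_sum: "(\<Sum>b\<in>B. q b u *\<^sub>R b) = u"
    using Pq[of u] P[of u 0] u rep subspace_0
    unfolding gr_local_rep_def complement_def V_def by fastforce
  have "((\<lambda>t. P (c t) + (\<Sum>b\<in>B. q b (c t) *\<^sub>R \<phi> t b)) has_vector_derivative
      P c' + (\<Sum>b\<in>B. q b (c t0) *\<^sub>R D b + q b c' *\<^sub>R \<phi> t0 b)) (at t0 within T)"
    by (intro has_vector_derivative_add has_vector_derivative_sum has_vector_derivative_scaleR
          bounded_linear.has_vector_derivative[OF bP c] D)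
       (use bounded_linear.has_vector_derivative[OF bq c] B(1) in
          \<open>auto simp: has_real_derivative_iff_has_vector_derivative\<close>)
  then have "(c has_vector_derivative P c' + (\<Sum>b\<in>B. q b (c t0) *\<^sub>R D b + q b c' *\<^sub>R \<phi> t0 b))
      (at t0 within T)"
    by (rule has_vector_derivative_transform_within[where d = "min \<delta> \<epsilon>"])
       (use \<delta> \<epsilon> t0 eq in auto)
  from vector_derivative_unique_within[OF nontriv c this]
  have "c' - P c' = (\<Sum>b\<in>B. q b (c t0) *\<^sub>R D b + q b c' *\<^sub>R \<phi> t0 b)"
    by (metis add_diff_cancel_left')
  also have "\<dots> = (\<Sum>b\<in>B. q b u *\<^sub>R D b)"
    using zero c0 by (intro sum.cong) auto
  finally have c': "c' - P c' = (\<Sum>b\<in>B. q b u *\<^sub>R D b)" .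
  \<comment> \<open>Near \<open>t0\<close> each \<open>\<phi> t\<close> is linear, hence so is \<open>D\<close> on the expansion of \<open>u\<close>.\<close>
  have "((\<lambda>t. \<Sum>b\<in>B. q b u *\<^sub>R \<phi> t b) has_vector_derivative (\<Sum>b\<in>B. q b u *\<^sub>R D b)) (at t0 within T)"
    by (intro has_vector_derivative_sum bounded_linear.has_vector_derivative[OF bounded_linear_scaleR_right] D)
       (use B(1) in auto)
  then have "((\<lambda>t. \<phi> t u) has_vector_derivative (\<Sum>b\<in>B. q b u *\<^sub>R D b)) (at t0 within T)"
  proof (rule has_vector_derivative_transform_within[where d = \<epsilon>])
    fix t assume "t \<in> T" "dist t t0 < \<epsilon>"
    then have "\<phi> t (\<Sum>b\<in>B. q b u *\<^sub>R b) = (\<Sum>b\<in>B. q b u *\<^sub>R \<phi> t b)"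
      by (intro linear_between_sum[OF sV lb finB B(1)])
    then show "(\<Sum>b\<in>B. q b u *\<^sub>R \<phi> t b) = \<phi> t u" by (simp add: u_sum)
  qed (use \<epsilon> t0 in auto)
  then have "D u = (\<Sum>b\<in>B. q b u *\<^sub>R D b)"
    using vector_derivative_unique_within[OF nontriv D[of u]] u by (simp add: V_def)
  with c' have "c' - D u = P c'" by (metis diff_diff_eq2 add_diff_cancel_left' diff_add_cancel)
  then show ?thesis using PV[of c'] by (simp add: D_def V_def)
qed

lemma gr_local_rep_section:
  assumes rep: "gr_local_rep T \<gamma> t0 C \<phi>" and u: "u \<in> \<gamma> t0"
  shows "\<forall>\<^sub>F t in at t0 within T. u + \<phi> t u \<in> \<gamma> t"
proof -
  obtain \<epsilon> where "\<epsilon> > 0" and "\<And>t. t \<in> T \<inter> ball t0 \<epsilon> \<Longrightarrow> \<gamma> t = graph_of (\<gamma> t0) (\<phi> t)"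
    using rep unfolding gr_local_rep_def by blast
  then show ?thesis
    using u unfolding eventually_at by (auto simp: graph_of_def dist_commute intro!: exI[of _ \<epsilon>])
qed

lemma gr_local_rep_section_derivative:
  assumes rep: "gr_local_rep T \<gamma> t0 C \<phi>" and "t0 \<in> T" "u \<in> \<gamma> t0"
  shows "((\<lambda>t. u + \<phi> t u) has_vector_derivative vector_derivative (\<lambda>t. \<phi> t u) (at t0 within T))
           (at t0 within T)"
  using has_vector_derivative_add[OF has_vector_derivative_const gr_local_rep_has_derivative[OF assms]]
  by simp

text \<open>
  Two charts give the same class because \<open>u + \<psi> t u\<close> is a section whose derivative can be
  computed in either of them.
\<close>

lemma gr_velocity_eq:
  fixes \<gamma> :: "real \<Rightarrow> 'g::real_normed_vector set"
  assumes fin: "finite S" and span: "span S = (UNIV :: 'g set)"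
    and V: "subspace (\<gamma> t0)" and rep: "gr_local_rep T \<gamma> t0 C \<phi>"
    and t0: "t0 \<in> T" and nontriv: "at t0 within T \<noteq> bot"
  shows "gr_velocity T \<gamma> t0 =
    (\<lambda>u\<in>\<gamma> t0. quot_proj (\<gamma> t0) (vector_derivative (\<lambda>t. \<phi> t u) (at t0 within T)))"
  unfolding gr_velocity_def
proof (rule the_equality)
  fix \<xi> assume "\<exists>C \<psi>. gr_local_rep T \<gamma> t0 C \<psi> \<and>
     \<xi> = (\<lambda>u\<in>\<gamma> t0. quot_proj (\<gamma> t0) (vector_derivative (\<lambda>t. \<psi> t u) (at t0 within T)))"
  then obtain C' \<psi> where rep': "gr_local_rep T \<gamma> t0 C' \<psi>"
    and \<xi>: "\<xi> = (\<lambda>u\<in>\<gamma> t0. quot_proj (\<gamma> t0) (vector_derivative (\<lambda>t. \<psi> t u) (at t0 within T)))"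
    by blast
  have "quot_proj (\<gamma> t0) (vector_derivative (\<lambda>t. \<psi> t u) (at t0 within T)) =
        quot_proj (\<gamma> t0) (vector_derivative (\<lambda>t. \<phi> t u) (at t0 within T))" if u: "u \<in> \<gamma> t0" for u
    unfolding quot_proj_eq_iff[OF V]
    by (rule velocity_of_section[OF fin span V rep t0 nontriv
          gr_local_rep_section_derivative[OF rep' t0 u] gr_local_rep_section[OF rep' u] _ u])
       (simp add: gr_local_rep_zero[OF rep' V t0 u])
  then show "\<xi> = (\<lambda>u\<in>\<gamma> t0. quot_proj (\<gamma> t0) (vector_derivative (\<lambda>t. \<phi> t u) (at t0 within T)))"
    unfolding \<xi> by (rule restrict_ext)
qed (use rep in blast)

section \<open>Linear maps to the quotient as cochains of degree zero\<close>

lemma quot_proj_in_hom_quot: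
  assumes I: "subspace I"
    and lin: "\<And>u v r s. u \<in> I \<Longrightarrow> v \<in> I \<Longrightarrow>
      (r *\<^sub>R d u + s *\<^sub>R d v) - d (r *\<^sub>R u + s *\<^sub>R v) \<in> I"
  shows "(\<lambda>u\<in>I. quot_proj I (d u)) \<in> hom_quot I"
proof -
  have "quot_proj I (d (r *\<^sub>R u + s *\<^sub>R v)) = quot_proj I (r *\<^sub>R d u + s *\<^sub>R d v)"
    if "u \<in> I" "v \<in> I" for u v r s
    using lin[OF that] quot_proj_eq_iff[OF I] by metis
  then show ?thesis
    using I by (auto simp: hom_quot_def quot_space_def quot_scale_proj quot_add_proj
        subspace_add subspace_scale)
qed

lemma cochain0_in_ce_cochains:
  assumes "\<xi> \<in> hom_quot I"
  shows "cochain0 \<xi> \<in> ce_cochains I 0"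
  using assms by (auto simp: ce_cochains_def cochain0_def)

lemma quot_proj_rep_proj:
  assumes "subspace I"
  shows "quot_proj I (quot_rep (quot_proj I x)) = quot_proj I x"
  unfolding quot_proj_eq_iff[OF assms] by (rule quot_rep_proj[OF assms])

text \<open>In degree \<open>0\<close> the bracket sum is empty and each of the other two has a single term.\<close>

lemma cochain0_cocycle_iff:
  assumes lie: "fd_lie_algebra br" and ideal: "lie_ideal br I"
    and \<xi>: "(\<lambda>u\<in>I. quot_proj I (d u)) \<in> hom_quot I"
  shows "cochain0 (\<lambda>u\<in>I. quot_proj I (d u)) \<in> ce_cocycles br I 0 \<longleftrightarrow>
    (\<forall>x. \<forall>u\<in>I. br x (d u) - d (br x u) \<in> I)"
proof -
  define f where "f = cochain0 (\<lambda>u\<in>I. quot_proj I (d u))"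
  have I: "subspace I" and id: "\<And>x u. u \<in> I \<Longrightarrow> br x u \<in> I"
    using ideal by (auto simp: lie_ideal_def)
  have empty: "{(a, b). a < b \<and> b = (0::nat)} = {}" by auto
  have diff: "ce_diff br I 0 f [x] u = quot_proj I (br x (d u) - d (br x u))" if "u \<in> I" for x u
    using that id[OF that, of x]
    by (simp add: ce_diff_def f_def cochain0_def omit_def empty quot_sum_def quot_proj_rep_proj[OF I]
        quot_bracket_proj[OF lie ideal] quot_scale_proj[OF I] quot_add_proj[OF I]
        quot_add_proj[OF I, unfolded quot_add_def])
  have "ce_diff br I 0 f = ce_zero I 1 \<longleftrightarrow>
      (\<forall>x. \<forall>u\<in>I. quot_proj I (br x (d u) - d (br x u)) = quot_proj I 0)"
  proof
    assume eq: "ce_diff br I 0 f = ce_zero I 1"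
    show "\<forall>x. \<forall>u\<in>I. quot_proj I (br x (d u) - d (br x u)) = quot_proj I 0"
    proof (intro allI ballI)
      fix x u assume u: "u \<in> I"
      have "ce_zero I 1 [x] u = quot_proj I 0"
        using u by (simp add: ce_zero_def hom_quot_zero_def)
      then show "quot_proj I (br x (d u) - d (br x u)) = quot_proj I 0"
        using diff[OF u] eq by simp
    qed
  next
    assume R: "\<forall>x. \<forall>u\<in>I. quot_proj I (br x (d u) - d (br x u)) = quot_proj I 0"
    show "ce_diff br I 0 f = ce_zero I 1"
    proof (intro ext)
      fix xs u
      show "ce_diff br I 0 f xs u = ce_zero I 1 xs u"
      proof (cases "length xs = 1 \<and> u \<in> I")
        case True
        then obtain x where xs: "xs = [x]" by (auto simp: length_Suc_conv)
        show ?thesis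
          using diff[of u x] R True by (simp add: xs ce_zero_def hom_quot_zero_def)
      next
        case False
        then show ?thesis
          by (auto simp: ce_diff_def ce_zero_def hom_quot_zero_def restrict_def)
      qed
    qed
  qed
  then show ?thesis
    using cochain0_in_ce_cochains[OF \<xi>] quot_proj_eq_iff[OF I]
    by (simp add: ce_cocycles_def f_def)
qed

section \<open>Velocities of deformations of ideals\<close>

theorem proposition4p2:
  fixes br :: "'g::real_normed_vector \<Rightarrow> 'g \<Rightarrow> 'g"
    and I :: "'g set"
    and k :: nat
    and \<gamma> :: "real \<Rightarrow> 'g set"
  assumes "fd_lie_algebra br"
    and "lie_ideal br I"
    and "dim I = k"
    and "smooth_ideal_deformation br k I \<gamma>"
  shows "cochain0 (gr_velocity {0..1} \<gamma> 0) \<in> ce_cocycles br I 0"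
proof -
  let ?T = "{0..1} :: real set"
  obtain S :: "'g set" where fin: "finite S" and span: "span S = UNIV" and bil: "bilinear br"
    using assms(1) unfolding fd_lie_algebra_def by blast
  have \<gamma>0: "\<gamma> 0 = I" and ideal: "\<And>t. t \<in> ?T \<Longrightarrow> lie_ideal br (\<gamma> t)"
    using assms(4) unfolding smooth_ideal_deformation_def by auto
  have I: "subspace I" using assms(2) by (simp add: lie_ideal_def)
  obtain C \<phi> where rep: "gr_local_rep ?T \<gamma> 0 C \<phi>"
    using assms(4) unfolding smooth_ideal_deformation_def smooth_gr_curve_def by fastforce
  have t0: "(0::real) \<in> ?T" and nontriv: "at 0 within ?T \<noteq> bot"
    by (auto simp: trivial_limit_within islimpt_Icc)
  have V: "subspace (\<gamma> 0)" using I \<gamma>0 by simp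
  define d where "d u = vector_derivative (\<lambda>t. \<phi> t u) (at 0 within ?T)" for u
  note sect = gr_local_rep_section[OF rep, unfolded \<gamma>0]
  note sect_derivative = gr_local_rep_section_derivative[OF rep t0, folded d_def, unfolded \<gamma>0]
  note zero = gr_local_rep_zero[OF rep V t0, unfolded \<gamma>0]
  note velocity = velocity_of_section[OF fin span V rep t0 nontriv, folded d_def, unfolded \<gamma>0]
  have in_T: "\<forall>\<^sub>F t in at 0 within ?T. t \<in> ?T"
    by (simp add: eventually_at_filter)
  have linear: "(r *\<^sub>R d u + s *\<^sub>R d v) - d (r *\<^sub>R u + s *\<^sub>R v) \<in> I" if uv: "u \<in> I" "v \<in> I" for u v r s
  proof (rule velocity)
    show "((\<lambda>t. r *\<^sub>R (u + \<phi> t u) + s *\<^sub>R (v + \<phi> t v)) has_vector_derivative r *\<^sub>R d u + s *\<^sub>R d v)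
        (at 0 within ?T)"
      by (intro has_vector_derivative_add sect_derivative uv
            bounded_linear.has_vector_derivative[OF bounded_linear_scaleR_right])
    show "\<forall>\<^sub>F t in at 0 within ?T. r *\<^sub>R (u + \<phi> t u) + s *\<^sub>R (v + \<phi> t v) \<in> \<gamma> t"
      using sect[OF uv(1)] sect[OF uv(2)] in_T
      by eventually_elim
         (use ideal in \<open>auto simp: lie_ideal_def intro!: subspace_add subspace_scale\<close>)
  qed (use uv I in \<open>auto simp: zero intro: subspace_add subspace_scale\<close>)
  have cocycle: "br x (d u) - d (br x u) \<in> I" if u: "u \<in> I" for x u
  proof (rule velocity)
    have "bounded_linear (br x)"
      using bil by (intro finite_dim_linear_imp_bounded_linear[OF fin span]) (simp add: bilinear_def)
    from bounded_linear.has_vector_derivative[OF this sect_derivative[OF u]]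
    show "((\<lambda>t. br x (u + \<phi> t u)) has_vector_derivative br x (d u)) (at 0 within ?T)" .
    show "\<forall>\<^sub>F t in at 0 within ?T. br x (u + \<phi> t u) \<in> \<gamma> t"
      using sect[OF u] in_T by eventually_elim (use ideal in \<open>auto simp: lie_ideal_def\<close>)
  qed (use u assms(2) in \<open>auto simp: zero lie_ideal_def\<close>)
  have "gr_velocity ?T \<gamma> 0 = (\<lambda>u\<in>I. quot_proj I (d u))"
    using gr_velocity_eq[OF fin span V rep t0 nontriv] by (simp add: \<gamma>0 d_def)
  then show ?thesis
    using cochain0_cocycle_iff[OF assms(1,2) quot_proj_in_hom_quot[OF I linear]] cocycle
    by simp
qed

end
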